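(* Let $\mathbf{E}=(\mathbf{e}_S)_{S\in\mathcal{M}}$ be a suite of $e$-values that does not depend on $\alpha$. Then $(\mathcal{R}_\alpha(\mathbf{E}))_{\alpha\in(0,1]}$ controls FDR with post hoc $\alpha$, that is, for every $\mathrm{P}\in M$, $$\mathrm{E}_\mathrm{P}\bigg(\sup_{\alpha\in(0,1]}\ \max_{R\in\mathcal{R}_\alpha(\mathbf{E})}\frac{|R\cap N_\mathrm{P}|}{\alpha(|R|\vee1)}\bigg)\le1.$$
   Context: Setting: $M$ is a set of probability measures on a common measurable space on which all random objects are defined. $m\ge1$, $[m]=\{1,\dots,m\}$, and hypotheses $H_1,\dots,H_m\subseteq M$ are given. For $\mathrm{P}\in M$, $N_\mathrm{P}=\{i\in[m]:\mathrm{P}\in H_i\}$ and $\mathrm{E}_\mathrm{P}$ is expectation under $\mathrm{P}$. Write $a\vee b=\max(a,b)$ and $\mathcal{M}=2^{[m]}\setminus\{\emptyset\}$. For $S\subseteq[m]$ the partitioning hypothesis is $H_S=\{\mathrm{P}\in M:N_\mathrm{P}=S\}$. An $e$-value for $H\subseteq M$ is a random variable $\mathbf{e}$ with values in $[0,\infty]$ such that $\mathrm{E}_\mathrm{P}(\mathbf{e})\le1$ for all $\mathrm{P}\in H$. A suite of $e$-values is a family $\mathbf{E}=(\mathbf{e}_S)_{S\in\mathcal{M}}$ where $\mathbf{e}_S$ is an $e$-value for $H_S$ for every $S\in\mathcal{M}$. For $\alpha\in(0,1]$, $$\mathcal{R}_\alpha(\mathbf{E})=\Big\{R\in2^{[m]}:\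 \alpha\,\mathbf{e}_S\ge\frac{|R\cap S|}{|R|\vee1}\ \text{for all }S\in\mathcal{M}\Big\}$$ (this random collection always contains $\emptyset$). *)

theory Defs
  imports "HOL-Probability.Probability"
begin

text \<open>
  Probability measures on a common measurable space are modelled as elements of
  \<^typ>\<open>'a measure\<close> that share the sigma-algebra of \<open>\<Omega>\<close>; the measure component
  of \<open>\<Omega>\<close> itself is irrelevant.
\<close>

definition prob_model :: "'a measure \<Rightarrow> 'a measure set \<Rightarrow> bool" where
  "prob_model \<Omega> M \<longleftrightarrow> (\<forall>P\<in>M. prob_space P \<and> sets P = sets \<Omega>)"

definition true_hyps :: "nat \<Rightarrow> (nat \<Rightarrow> 'a measure set) \<Rightarrow> 'a measure \<Rightarrow> nat set" where
  "true_hyps m H P = {i \<in> {1..m}. P \<in> H i}"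

definition nonempty_index_sets :: "nat \<Rightarrow> nat set set" where
  "nonempty_index_sets m = Pow {1..m} - {{}}"

definition partitioning_hyp ::
  "'a measure set \<Rightarrow> nat \<Rightarrow> (nat \<Rightarrow> 'a measure set) \<Rightarrow> nat set \<Rightarrow> 'a measure set" where
  "partitioning_hyp M m H S = {P \<in> M. true_hyps m H P = S}"

definition e_value :: "'a measure \<Rightarrow> 'a measure set \<Rightarrow> ('a \<Rightarrow> ennreal) \<Rightarrow> bool" where
  "e_value \<Omega> H0 e \<longleftrightarrow> e \<in> borel_measurable \<Omega> \<and> (\<forall>P\<in>H0. (\<integral>\<^sup>+\<omega>. e \<omega> \<partial>P) \<le> 1)"

definition e_value_suite ::
  "'a measure \<Rightarrow> 'a measure set \<Rightarrow> nat \<Rightarrow> (nat \<Rightarrow> 'a measure set) \<Rightarrow> (nat set \<Rightarrow> 'a \<Rightarrow> ennreal) \<Rightarrow> bool"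
  where
  "e_value_suite \<Omega> M m H E \<longleftrightarrow>
     (\<forall>S\<in>nonempty_index_sets m. e_value \<Omega> (partitioning_hyp M m H S) (E S))"

definition rejection_collection ::
  "nat \<Rightarrow> (nat set \<Rightarrow> 'a \<Rightarrow> ennreal) \<Rightarrow> real \<Rightarrow> 'a \<Rightarrow> nat set set" where
  "rejection_collection m E \<alpha> \<omega> =
     {R \<in> Pow {1..m}. \<forall>S\<in>nonempty_index_sets m.
        ennreal \<alpha> * E S \<omega> \<ge> ennreal (real (card (R \<inter> S)) / real (max (card R) 1))}"

definition post_hoc_loss :: "(real \<Rightarrow> 'a \<Rightarrow> nat set set) \<Rightarrow> nat set \<Rightarrow> 'a \<Rightarrow> ennreal" where
  "post_hoc_loss \<R> N \<omega> =
     (SUP \<alpha>\<in>{0<..1}. Max ((\<lambda>R. ennreal (real (card (R \<inter> N)) / (\<alpha> * real (max (card R) 1)))) ` \<R> \<alpha> \<omega>))"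

text \<open>
  The Lebesgue integral \<open>nn_integral\<close> of a non-measurable function is a lower integral.
  Since the supremum ranges over uncountably many levels, measurability is required
  explicitly, so that the bound really concerns an expectation. The collections are meant
  to be finite and nonempty (they contain the empty set), so that \<^const>\<open>Max\<close> is a maximum.
\<close>

definition controls_fdr_post_hoc ::
  "'a measure \<Rightarrow> 'a measure set \<Rightarrow> nat \<Rightarrow> (nat \<Rightarrow> 'a measure set) \<Rightarrow> (real \<Rightarrow> 'a \<Rightarrow> nat set set) \<Rightarrow> bool"
  where
  "controls_fdr_post_hoc \<Omega> M m H \<R> \<longleftrightarrow>
     (\<forall>P\<in>M. post_hoc_loss \<R> (true_hyps m H P) \<in> borel_measurable \<Omega> \<and>
            (\<integral>\<^sup>+\<omega>. post_hoc_loss \<R> (true_hyps m H P) \<omega> \<partial>P) \<le> 1)"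

end

theory Submission
  imports Defs
begin

text \<open>
  If \<open>R\<close> is rejected at level \<open>\<alpha>\<close>, the constraint for the set \<open>S = N\<close> of true hypotheses says
  that the loss of \<open>R\<close> at \<open>\<alpha>\<close> is at most \<open>E N\<close>, whatever \<open>\<alpha>\<close> is; so the supremum is at most
  \<open>E N\<close> as well. It is measurable because the collections grow with \<open>\<alpha>\<close> and the loss of a fixed
  \<open>R\<close> is continuous in \<open>\<alpha>\<close>, so that rational levels suffice.
\<close>

text \<open>The level-free quotient common to both sides of the argument: with \<open>S\<close> in
  place of \<open>N\<close> it is what the constraints compare, and divided by \<alpha> it is the
  loss.\<close>

definition false_discovery_proportion :: "nat set \<Rightarrow> nat set \<Rightarrow> real" where
  "false_discovery_proportion N R = real (card (R \<inter> N)) / real (max (card R) 1)"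

lemma false_discovery_proportion_nonneg [simp]: "0 \<le> false_discovery_proportion N R"
  by (simp add: false_discovery_proportion_def)

lemma rejection_collection_iff:
  "R \<in> rejection_collection m E \<alpha> \<omega> \<longleftrightarrow> R \<subseteq> {1..m} \<and>
     (\<forall>S\<in>nonempty_index_sets m. ennreal (false_discovery_proportion S R) \<le> ennreal \<alpha> * E S \<omega>)"
  by (auto simp: rejection_collection_def false_discovery_proportion_def)

lemma finite_nonempty_index_sets: "finite (nonempty_index_sets m)"
  by (simp add: nonempty_index_sets_def)

lemma empty_in_rejection_collection: "{} \<in> rejection_collection m E \<alpha> \<omega>"
  by (simp add: rejection_collection_iff false_discovery_proportion_def)

lemma finite_rejection_collection: "finite (rejection_collection m E \<alpha> \<omega>)"
  by (simp add: rejection_collection_def)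

text \<open>Used to move a rejected set from a real level up to a nearby rational one.\<close>

lemma rejection_collection_mono:
  assumes "\<alpha> \<le> \<beta>"
  shows "rejection_collection m E \<alpha> \<omega> \<subseteq> rejection_collection m E \<beta> \<omega>"
proof -
  have "ennreal \<alpha> * E S \<omega> \<le> ennreal \<beta> * E S \<omega>" for S
    using assms by (intro mult_right_mono ennreal_leI) auto
  then show ?thesis
    unfolding rejection_collection_iff subset_iff by (meson order_trans)
qed

text \<open>The collections are finite and contain the empty set, so \<open>Max\<close> is a
  supremum and complete-lattice rules apply to both layers.\<close>

lemma post_hoc_loss_rejection_collection:
  "post_hoc_loss (rejection_collection m E) N \<omega> =
     (SUP \<alpha>\<in>{0<..1}. SUP R\<in>rejection_collection m E \<alpha> \<omega>.
        ennreal (false_discovery_proportion N R / \<alpha>))"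
  unfolding post_hoc_loss_def
proof (rule SUP_cong[OF refl])
  fix \<alpha> :: real
  let ?f = "\<lambda>R. ennreal (real (card (R \<inter> N)) / (\<alpha> * real (max (card R) 1)))"
  have "Max (?f ` rejection_collection m E \<alpha> \<omega>) = (SUP R\<in>rejection_collection m E \<alpha> \<omega>. ?f R)"
    using finite_rejection_collection[of m E \<alpha> \<omega>] empty_in_rejection_collection[of m E \<alpha> \<omega>]
    by (intro cSup_eq_Max[symmetric]) auto
  then show "Max (?f ` rejection_collection m E \<alpha> \<omega>) =
      (SUP R\<in>rejection_collection m E \<alpha> \<omega>. ennreal (false_discovery_proportion N R / \<alpha>))"
    by (simp add: false_discovery_proportion_def mult.commute)
qed

lemma post_hoc_loss_rejection_collection_le:
  assumes "N \<in> nonempty_index_sets m"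
  shows "post_hoc_loss (rejection_collection m E) N \<omega> \<le> E N \<omega>"
  unfolding post_hoc_loss_rejection_collection
proof (intro SUP_least)
  fix \<alpha> R assume \<alpha>: "\<alpha> \<in> {0<..1::real}" and "R \<in> rejection_collection m E \<alpha> \<omega>"
  then have le: "ennreal (false_discovery_proportion N R) \<le> ennreal \<alpha> * E N \<omega>"
    using assms by (simp add: rejection_collection_iff)
  have "ennreal (false_discovery_proportion N R / \<alpha>) =
      ennreal (1 / \<alpha>) * ennreal (false_discovery_proportion N R)"
    using \<alpha> by (simp add: ennreal_mult[symmetric])
  also have "\<dots> \<le> ennreal (1 / \<alpha>) * (ennreal \<alpha> * E N \<omega>)"
    using le by (rule mult_left_mono) simp
  \<comment> \<open>\<open>E N \<omega>\<close> may be infinite, so the cancellation is carried out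
    between the two finite factors only.\<close>
  also have "\<dots> = ennreal (1 / \<alpha> * \<alpha>) * E N \<omega>"
    using \<alpha> by (subst ennreal_mult) (auto simp: mult.assoc)
  also have "\<dots> = E N \<omega>"
    using \<alpha> by simp
  finally show "ennreal (false_discovery_proportion N R / \<alpha>) \<le> E N \<omega>" .
qed

text \<open>The suite has no e-value for the empty set, so this case cannot go through the bound by
  \<open>E N\<close>; here every numerator vanishes.\<close>

lemma post_hoc_loss_no_true_hyps:
  "post_hoc_loss (rejection_collection m E) {} \<omega> = 0"
  unfolding post_hoc_loss_rejection_collection
  by (simp add: false_discovery_proportion_def bot_ennreal[symmetric])

text \<open>Raising \<alpha> slightly to a rational \<beta> keeps \<open>R\<close> rejected and
  lowers its loss by as little as desired. This makes the supremum countable.\<close>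

lemma post_hoc_loss_rational_levels:
  "post_hoc_loss (rejection_collection m E) N \<omega> =
     (SUP \<alpha>\<in>{0<..1} \<inter> \<rat>. SUP R\<in>rejection_collection m E \<alpha> \<omega>.
        ennreal (false_discovery_proportion N R / \<alpha>))" (is "_ = ?rhs")
  unfolding post_hoc_loss_rejection_collection
proof (rule antisym)
  show "(SUP \<alpha>\<in>{0<..1}. SUP R\<in>rejection_collection m E \<alpha> \<omega>.
      ennreal (false_discovery_proportion N R / \<alpha>)) \<le> ?rhs"
  proof (intro SUP_least)
    fix \<alpha> :: real and R
    assume \<alpha>: "\<alpha> \<in> {0<..1}" and R: "R \<in> rejection_collection m E \<alpha> \<omega>"
    let ?q = "false_discovery_proportion N R"
    have bound: "ennreal (?q / \<beta>) \<le> ?rhs" if "\<alpha> \<le> \<beta>" "\<beta> \<le> 1" "\<beta> \<in> \<rat>" for \<beta>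
      using that \<alpha> R rejection_collection_mono[of \<alpha> \<beta> m E \<omega>]
      by (intro SUP_upper2[where i = \<beta>] SUP_upper2[where i = R]) auto
    show "ennreal (?q / \<alpha>) \<le> ?rhs"
    \<comment> \<open>At level 1 there is no room to move upwards, but 1 is itself rational.\<close>
    proof (cases "\<alpha> = 1")
      case True
      then show ?thesis using bound[of 1] by simp
    next
      case False
      show ?thesis
      proof (rule dense_le)
        fix y assume y: "y < ennreal (?q / \<alpha>)"
        then obtain t where t: "y = ennreal t" "0 \<le> t"
          by (cases y) auto
        have less: "t < ?q / \<alpha>"
          using y t by (simp add: ennreal_less_iff)
        show "y \<le> ?rhs"
        \<comment> \<open>The choice of \<beta> below divides by \<open>t\<close>, and
          \<open>?q / 0\<close> is 0 by convention.\<close>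
        proof (cases "t = 0")
          case True
          then show ?thesis using t by simp
        next
          case False
          then have "0 < t" using t by simp
          \<comment> \<open>Below 1, \<beta> is an admissible level; below \<open>?q / t\<close>,
            the loss of \<open>R\<close> at \<beta> still exceeds \<open>t\<close>.\<close>
          then have "\<alpha> < min 1 (?q / t)"
            using less \<alpha> \<open>\<alpha> \<noteq> 1\<close> by (auto simp: field_simps)
          then obtain \<beta> where \<beta>: "\<beta> \<in> \<rat>" "\<alpha> < \<beta>" "\<beta> < min 1 (?q / t)"
            using Rats_dense_in_real by blast
          then have "t \<le> ?q / \<beta>"
            using \<open>0 < t\<close> \<alpha> by (auto simp: field_simps)
          then have "y \<le> ennreal (?q / \<beta>)"
            using t by (simp add: ennreal_leI)
          also have "\<dots> \<le> ?rhs"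
            using \<beta> by (intro bound) auto
          finally show ?thesis .
        qed
      qed
    qed
  qed
qed (rule SUP_subset_mono; auto)

lemma borel_measurable_post_hoc_loss:
  assumes E: "\<And>S. S \<in> nonempty_index_sets m \<Longrightarrow> E S \<in> borel_measurable \<Omega>"
  shows "post_hoc_loss (rejection_collection m E) N \<in> borel_measurable \<Omega>"
proof -
  \<comment> \<open>The collection depends on \<omega>, so the supremum is taken over all subsets
    instead and membership becomes a case distinction. The default 0 is the least element of
    \<open>ennreal\<close> and leaves the supremum unchanged.\<close>
  let ?f = "\<lambda>R \<alpha> \<omega>. if \<forall>S\<in>nonempty_index_sets m.
      ennreal (false_discovery_proportion S R) \<le> ennreal \<alpha> * E S \<omega>
    then ennreal (false_discovery_proportion N R / \<alpha>) else 0"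
  have "(SUP R\<in>rejection_collection m E \<alpha> \<omega>. ennreal (false_discovery_proportion N R / \<alpha>)) =
      (SUP R\<in>Pow {1..m}. ?f R \<alpha> \<omega>)" for \<alpha> \<omega>
  proof (rule antisym)
    show "(SUP R\<in>rejection_collection m E \<alpha> \<omega>. ennreal (false_discovery_proportion N R / \<alpha>)) \<le>
        (SUP R\<in>Pow {1..m}. ?f R \<alpha> \<omega>)"
      by (rule SUP_mono) (auto simp: rejection_collection_iff)
    show "(SUP R\<in>Pow {1..m}. ?f R \<alpha> \<omega>) \<le>
        (SUP R\<in>rejection_collection m E \<alpha> \<omega>. ennreal (false_discovery_proportion N R / \<alpha>))"
      by (rule SUP_least) (auto simp: rejection_collection_iff intro: SUP_upper)
  qed
  then have loss: "post_hoc_loss (rejection_collection m E) N =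
      (\<lambda>\<omega>. SUP \<alpha>\<in>{0<..1} \<inter> \<rat>. SUP R\<in>Pow {1..m}. ?f R \<alpha> \<omega>)"
    by (simp add: fun_eq_iff post_hoc_loss_rational_levels)
  have "Measurable.pred \<Omega> (\<lambda>\<omega>. \<forall>S\<in>nonempty_index_sets m.
      ennreal (false_discovery_proportion S R) \<le> ennreal \<alpha> * E S \<omega>)" for R and \<alpha> :: real
  proof (intro pred_intros_finite finite_nonempty_index_sets)
    fix S assume "S \<in> nonempty_index_sets m"
    note E[OF this, measurable]
    show "Measurable.pred \<Omega> (\<lambda>\<omega>. ennreal (false_discovery_proportion S R) \<le> ennreal \<alpha> * E S \<omega>)"
      by measurable
  qed
  then have "?f R \<alpha> \<in> borel_measurable \<Omega>" for R \<alpha>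
    by (intro measurable_If) auto
  moreover have "countable ({0<..1} \<inter> \<rat> :: real set)" "countable (Pow {1..m})"
    using countable_rat by (auto intro: countable_subset countable_finite)
  ultimately show ?thesis
    unfolding loss by (intro borel_measurable_SUP) auto
qed

theorem theorem6:
  fixes \<Omega> :: "'a measure" and M :: "'a measure set" and m :: nat
    and H :: "nat \<Rightarrow> 'a measure set" and E :: "nat set \<Rightarrow> 'a \<Rightarrow> ennreal"
  assumes "prob_model \<Omega> M"
    and "m \<ge> 1"
    and "\<And>i. i \<in> {1..m} \<Longrightarrow> H i \<subseteq> M"
    and "e_value_suite \<Omega> M m H E"
  shows "controls_fdr_post_hoc \<Omega> M m H (rejection_collection m E)"
  unfolding controls_fdr_post_hoc_def
proof (intro ballI conjI)
  fix P assume P: "P \<in> M"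
  let ?N = "true_hyps m H P"
  have e: "e_value \<Omega> (partitioning_hyp M m H S) (E S)" if "S \<in> nonempty_index_sets m" for S
    using assms(4) that by (simp add: e_value_suite_def)
  then show "post_hoc_loss (rejection_collection m E) ?N \<in> borel_measurable \<Omega>"
    by (intro borel_measurable_post_hoc_loss) (auto simp: e_value_def)
  show "(\<integral>\<^sup>+\<omega>. post_hoc_loss (rejection_collection m E) ?N \<omega> \<partial>P) \<le> 1"
  proof (cases "?N = {}")
    case True
    then show ?thesis by (simp add: post_hoc_loss_no_true_hyps)
  next
    case False
    then have N: "?N \<in> nonempty_index_sets m"
      by (auto simp: nonempty_index_sets_def true_hyps_def)
    have "(\<integral>\<^sup>+\<omega>. post_hoc_loss (rejection_collection m E) ?N \<omega> \<partial>P) \<le> (\<integral>\<^sup>+\<omega>. E ?N \<omega> \<partial>P)"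
      by (intro nn_integral_mono post_hoc_loss_rejection_collection_le N)
    also have "\<dots> \<le> 1"
      \<comment> \<open>\<open>P\<close> lies in the partitioning hypothesis of its own set of true
        hypotheses, so \<open>E ?N\<close> has expectation at most 1 under \<open>P\<close>.\<close>
      using e[OF N] P by (simp add: e_value_def partitioning_hyp_def)
    finally show ?thesis .
  qed
qed

end
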